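(* Let $v\in\{\mathrm{MR},\mathrm{ZF}\}$, with $M_t>K$ in the case $v=\mathrm{ZF}$, and consider the full-band benchmark problem for $v$ described in the context. Put $$p_s^\star=\frac{\kappa}{M_tp_0+\kappa}P_{\max},\qquad S_c^\star=\frac{M_tp_0}{M_tp_0+\kappa}P_{\max},$$ $$\chi_k^{\mathrm{MR}}=\frac{M_t\eta_k}{\xi_kP_{\max}+\sigma_k^2},\qquad \chi_k^{\mathrm{ZF}}=\frac{(M_t-K)\eta_k}{\varepsilon_kS_c^\star+\xi_kp_s^\star+\sigma_k^2},$$ $$\gamma_k=2^{R_k^{\min}/(\zeta_{\mathrm{dl}}B_{\mathrm{sys}})}-1,\qquad \bar{\alpha}_{k,v}^{\min}=\frac{\gamma_k}{\chi_k^{v}},\qquad k=1,\dots,K.$$ Then the benchmark problem is feasible if and only if $$\sum_{k=1}^{K}\bar{\alpha}_{k,v}^{\min}\le S_c^\star .$$ If this condition holds, then at the optimum the sensing power is $p_s=p_s^\star$, the total communication power is $\sum_{k=1}^K\bar{\alpha}_k=S_c^\star$, and the optimal communication powers are given by $$\bar{\alpha}_{k,v}^{\star}=\max\Big\{\bar{\alpha}_{k,v}^{\min},\ \nu_v^\star-\frac{1}{\chi_k^{v}}\Big\},\qquad k=1,\dots,K,$$ where $\nu_v^\star$ is selected such that $\sum_{k=1}^{K}\bar{\alpha}_{k,v}^{\star}=S_c^\star$. The corresponding per-subcarrier powers are $\alpha_{k,n}^\star=\bar{\alpha}_{k,v}^\star/N_c$ and $q_n^\star=p_s^\star/N_c$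 for all $k$ and $n$.
   Context: Parameters: integers $K,M_t,N_c\ge 1$ (users, transmit antennas, subcarriers); real numbers $P_{\max}>0$ (power budget), $B_{\mathrm{sys}}>0$ (bandwidth), $\zeta_{\mathrm{dl}}\in(0,1]$ (downlink fraction), $p_0\in(0,1]$ (normalized sensing beampattern gain toward the target), $\kappa>0$ (threshold on the mainlobe-to-average-sidelobe ratio, MASR); and for each user $k=1,\dots,K$: $\eta_k>0$, $\varepsilon_k\ge 0$, $\xi_k=\eta_k+\varepsilon_k$ (channel-estimate variance, estimation-error variance, large-scale fading), noise power $\sigma_k^2>0$, and minimum rate $R_k^{\min}\ge 0$. Full-band setting: every user and the sensing waveform occupy all $N_c$ subcarriers with uniform loading, i.e. user $k$ has power $\alpha_{k,n}=\bar{\alpha}_k/N_c$ and sensing has power $q_n=p_s/N_c$ on every subcarrier $n$, where $\bar{\alpha}_k$ is the total communication power of user $k$ and $p_s$ is the total sensing power. Write $S_c=\sum_{k=1}^K\bar{\alpha}_k$. The SINRs for maximum-ratio (MR) and zero-forcing (ZF) precoding are $$\mathrm{SINR}_k^{\mathrm{MR}}=\frac{M_t\eta_k\bar{\alpha}_k}{\xi_k(S_c+p_s)+\sigma_k^2},\qquad \mathrm{SINR}_k^{\mathrm{ZF}}=\frac{(M_t-K)\eta_k\bar{\alpha}_k}{\varepsilon_kS_c+\xi_kp_s+\sigma_k^2},$$ and the rate of user $k$ is $R_k^v=\zeta_{\mathrm{dl}}B_{\mathrm{sys}}\log_2(1+\mathrm{SINR}_k^v)$. The full-band benchmark problem for $v\in\{\mathrm{MR},\mathrm{ZF}\}$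 is: maximize $\sum_{k=1}^KR_k^v$ over real $\bar{\alpha}_1,\dots,\bar{\alpha}_K,p_s$ subject to (i) $R_k^v\ge R_k^{\min}$ for all $k$; (ii) $M_tp_0p_s\ge\kappa S_c$; (iii) $S_c+p_s\le P_{\max}$; (iv) $\bar{\alpha}_k\ge 0$ for all $k$ and $p_s\ge 0$. The problem is called feasible if some $(\bar{\alpha}_1,\dots,\bar{\alpha}_K,p_s)$ satisfies (i)–(iv). *)

theory Defs
  imports Complex_Main
begin

datatype precoder = MR | ZF

text \<open>Users are indexed by \<open>{1..num_users}\<close> and subcarriers by \<open>{1..num_subcarriers}\<close>; values of
  user- or subcarrier-indexed functions outside these ranges are irrelevant.\<close>

record full_band_system =
  num_users :: nat              \<comment> \<open>\<open>K\<close>\<close>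
  num_antennas :: nat           \<comment> \<open>\<open>M_t\<close>\<close>
  num_subcarriers :: nat        \<comment> \<open>\<open>N_c\<close>\<close>
  P_max :: real
  B_sys :: real
  zeta_dl :: real
  sens_gain :: real             \<comment> \<open>\<open>p_0\<close>, normalized sensing beampattern gain toward the target\<close>
  masr_thr :: real              \<comment> \<open>\<open>\<kappa>\<close>, threshold on the mainlobe-to-average-sidelobe ratio\<close>
  eta :: "nat \<Rightarrow> real"          \<comment> \<open>channel-estimate variances\<close>
  eps :: "nat \<Rightarrow> real"          \<comment> \<open>estimation-error variances\<close>
  noise :: "nat \<Rightarrow> real"        \<comment> \<open>noise powers \<open>\<sigma>_k^2\<close> (already squared)\<close>
  R_min :: "nat \<Rightarrow> real"

abbreviation users :: "full_band_system \<Rightarrow> nat set" where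
  "users s \<equiv> {1..num_users s}"

abbreviation subcarriers :: "full_band_system \<Rightarrow> nat set" where
  "subcarriers s \<equiv> {1..num_subcarriers s}"

definition valid_system :: "full_band_system \<Rightarrow> bool" where
  "valid_system s \<longleftrightarrow>
     num_users s \<ge> 1 \<and> num_antennas s \<ge> 1 \<and> num_subcarriers s \<ge> 1 \<and>
     P_max s > 0 \<and> B_sys s > 0 \<and>
     0 < zeta_dl s \<and> zeta_dl s \<le> 1 \<and>
     0 < sens_gain s \<and> sens_gain s \<le> 1 \<and>
     masr_thr s > 0 \<and>
     (\<forall>k\<in>users s. eta s k > 0 \<and> eps s k \<ge> 0 \<and> noise s k > 0 \<and> R_min s k \<ge> 0)"

text \<open>Large-scale fading \<open>\<xi>_k\<close>.\<close>
definition xi :: "full_band_system \<Rightarrow> nat \<Rightarrow> real" where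
  "xi s k = eta s k + eps s k"

text \<open>In the following, \<open>a k\<close> is the total communication power of user \<open>k\<close> (summed over all
  subcarriers), and \<open>p\<close> is the total sensing power.\<close>

definition comm_power :: "full_band_system \<Rightarrow> (nat \<Rightarrow> real) \<Rightarrow> real" where
  "comm_power s a = (\<Sum>k\<in>users s. a k)"

fun SINR :: "full_band_system \<Rightarrow> precoder \<Rightarrow> (nat \<Rightarrow> real) \<Rightarrow> real \<Rightarrow> nat \<Rightarrow> real" where
  "SINR s MR a p k =
     real (num_antennas s) * eta s k * a k / (xi s k * (comm_power s a + p) + noise s k)"
| "SINR s ZF a p k =
     (real (num_antennas s) - real (num_users s)) * eta s k * a k
       / (eps s k * comm_power s a + xi s k * p + noise s k)"

definition rate :: "full_band_system \<Rightarrow> precoder \<Rightarrow> (nat \<Rightarrow> real) \<Rightarrow> real \<Rightarrow> nat \<Rightarrow> real" where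
  "rate s v a p k = zeta_dl s * B_sys s * log 2 (1 + SINR s v a p k)"

definition sum_rate :: "full_band_system \<Rightarrow> precoder \<Rightarrow> (nat \<Rightarrow> real) \<Rightarrow> real \<Rightarrow> real" where
  "sum_rate s v a p = (\<Sum>k\<in>users s. rate s v a p k)"

definition feasible_point :: "full_band_system \<Rightarrow> precoder \<Rightarrow> (nat \<Rightarrow> real) \<Rightarrow> real \<Rightarrow> bool" where
  "feasible_point s v a p \<longleftrightarrow>
     (\<forall>k\<in>users s. rate s v a p k \<ge> R_min s k) \<and>
     real (num_antennas s) * sens_gain s * p \<ge> masr_thr s * comm_power s a \<and>
     comm_power s a + p \<le> P_max s \<and>
     (\<forall>k\<in>users s. a k \<ge> 0) \<and> p \<ge> 0"

definition feasible_problem :: "full_band_system \<Rightarrow> precoder \<Rightarrow> bool" where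
  "feasible_problem s v \<longleftrightarrow> (\<exists>a p. feasible_point s v a p)"

definition optimal_point :: "full_band_system \<Rightarrow> precoder \<Rightarrow> (nat \<Rightarrow> real) \<Rightarrow> real \<Rightarrow> bool" where
  "optimal_point s v a p \<longleftrightarrow>
     feasible_point s v a p \<and>
     (\<forall>a' p'. feasible_point s v a' p' \<longrightarrow> sum_rate s v a' p' \<le> sum_rate s v a p)"

text \<open>\<open>A k n\<close> and \<open>q n\<close> are the communication power of user \<open>k\<close> and the sensing power on
  subcarrier \<open>n\<close>.\<close>
definition uniform_loading ::
    "full_band_system \<Rightarrow> (nat \<Rightarrow> real) \<Rightarrow> real \<Rightarrow> (nat \<Rightarrow> nat \<Rightarrow> real) \<Rightarrow> (nat \<Rightarrow> real) \<Rightarrow> bool" where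
  "uniform_loading s a p A q \<longleftrightarrow>
     (\<forall>n\<in>subcarriers s. (\<forall>k\<in>users s. A k n = a k / real (num_subcarriers s)) \<and>
                        q n = p / real (num_subcarriers s))"

definition ps_star :: "full_band_system \<Rightarrow> real" where
  "ps_star s = masr_thr s / (real (num_antennas s) * sens_gain s + masr_thr s) * P_max s"

definition Sc_star :: "full_band_system \<Rightarrow> real" where
  "Sc_star s = real (num_antennas s) * sens_gain s
                 / (real (num_antennas s) * sens_gain s + masr_thr s) * P_max s"

fun chi :: "full_band_system \<Rightarrow> precoder \<Rightarrow> nat \<Rightarrow> real" where
  "chi s MR k = real (num_antennas s) * eta s k / (xi s k * P_max s + noise s k)"
| "chi s ZF k = (real (num_antennas s) - real (num_users s)) * eta s k
     / (eps s k * Sc_star s + xi s k * ps_star s + noise s k)"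

definition gamma_min :: "full_band_system \<Rightarrow> nat \<Rightarrow> real" where
  "gamma_min s k = 2 powr (R_min s k / (zeta_dl s * B_sys s)) - 1"

definition a_min :: "full_band_system \<Rightarrow> precoder \<Rightarrow> nat \<Rightarrow> real" where
  "a_min s v k = gamma_min s k / chi s v k"

text \<open>The power \<open>\<alpha>_k\<close> at water level \<open>\<nu>\<close>.\<close>
definition a_star :: "full_band_system \<Rightarrow> precoder \<Rightarrow> real \<Rightarrow> nat \<Rightarrow> real" where
  "a_star s v \<nu> k = max (a_min s v k) (\<nu> - 1 / chi s v k)"

end

theory Submission
  imports Defs
begin

text \<open>Raising a feasible communication vector of total \<open>S > 0\<close> by the factor \<open>S\<^sup>\<star> / S\<close> while
  setting the sensing power to \<open>p\<^sub>s\<^sup>\<star>\<close> multiplies each interference term by at most that factor,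
  because the sensing constraint forces \<open>p\<^sub>s\<^sup>\<star> \<le> (S\<^sup>\<star> / S) p\<close>; the fixed noise makes the gain strict.
  Hence both budgets are tight at the optimum, where the SINR of user \<open>k\<close> is \<open>\<chi>\<^sub>k a\<^sub>k\<close>.
  What remains is a concave water-filling problem with lower bounds, solved by the tangent
  inequality \<open>ln x \<le> x - 1\<close>, whose equality case yields uniqueness.\<close>

section \<open>The tangent inequality and abstract water-filling\<close>

text \<open>Apply \<open>ln r \<le> r - 1\<close> to the quotient of the two arguments. The slope is
  written with denominator \<open>1 / c + y\<close> because this is exactly the water level \<nu>
  wherever \<open>y = \<nu> - 1 / c\<close>.\<close>

lemma ln_one_plus_le_tangent:
  fixes c x y :: real
  assumes "c > 0" "x \<ge> 0" "y \<ge> 0"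
  shows "ln (1 + c * x) \<le> ln (1 + c * y) + (x - y) / (1 / c + y)"
    and "x \<noteq> y \<Longrightarrow> ln (1 + c * x) < ln (1 + c * y) + (x - y) / (1 / c + y)"
proof -
  have px: "1 + c * x > 0" and py: "1 + c * y > 0"
    using assms by (simp_all add: add_pos_nonneg)
  define r where "r = (1 + c * x) / (1 + c * y)"
  have r: "r > 0" using px py by (simp add: r_def)
  have lnr: "ln r = ln (1 + c * x) - ln (1 + c * y)"
    using px py by (simp add: r_def ln_div)
  have "(x - y) / (1 / c + y) = (c * (x - y)) / (c * (1 / c + y))"
    using assms by simp
  also have "c * (1 / c + y) = 1 + c * y"
    using assms by (simp add: algebra_simps)
  also have "c * (x - y) / (1 + c * y) = r - 1"
    using py by (simp add: r_def field_simps)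
  finally have eq: "(x - y) / (1 / c + y) = r - 1" .
  show "ln (1 + c * x) \<le> ln (1 + c * y) + (x - y) / (1 / c + y)"
    using ln_le_minus_one[OF r] lnr eq by linarith
  assume "x \<noteq> y"
  hence "r \<noteq> 1" using assms py by (simp add: r_def)
  hence "ln r \<noteq> r - 1" using ln_eq_minus_one[OF r] by blast
  thus "ln (1 + c * x) < ln (1 + c * y) + (x - y) / (1 / c + y)"
    using ln_le_minus_one[OF r] lnr eq by linarith
qed

text \<open>For \<nu> > 0, \<open>1 / \<nu>\<close> acts as the Lagrange multiplier of the common
  sum: every tangent slope may be replaced by it, and the linear terms then cancel because the two
  sums agree.\<close>

lemma water_filling_strict:
  fixes c m a b :: "'i \<Rightarrow> real" and \<nu> :: real
  assumes fin: "finite I"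
    and c: "\<And>k. k \<in> I \<Longrightarrow> c k > 0"
    and m: "\<And>k. k \<in> I \<Longrightarrow> m k \<ge> 0"
    and b: "\<And>k. k \<in> I \<Longrightarrow> b k = max (m k) (\<nu> - 1 / c k)"
    and a: "\<And>k. k \<in> I \<Longrightarrow> a k \<ge> m k"
    and sums: "sum a I = sum b I"
    and diff: "\<exists>k\<in>I. a k \<noteq> b k"
  shows "(\<Sum>k\<in>I. ln (1 + c k * a k)) < (\<Sum>k\<in>I. ln (1 + c k * b k))"
proof (cases "\<nu> > 0")
  case True
  \<comment> \<open>Where the water level is reached, \<open>1 / c k + b k\<close> equals \<nu>. At
    the lower bound it is at least \<nu>, but there \<open>a k - b k\<close> is nonnegative, so the
    smaller denominator only enlarges the quotient.\<close>
  have slope: "(a k - b k) / (1 / c k + b k) \<le> (a k - b k) / \<nu>" if k: "k \<in> I" for k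
  proof (cases "m k \<le> \<nu> - 1 / c k")
    case True
    then show ?thesis using b[OF k] by simp
  next
    case False
    then have "b k = m k" "\<nu> \<le> 1 / c k + b k" using b[OF k] by auto
    then show ?thesis using \<open>\<nu> > 0\<close> a[OF k] by (intro divide_left_mono) auto
  qed
  have nonneg: "a k \<ge> 0" "b k \<ge> 0" if "k \<in> I" for k
    using m[OF that] a[OF that] b[OF that] by auto
  have "(\<Sum>k\<in>I. ln (1 + c k * a k)) < (\<Sum>k\<in>I. ln (1 + c k * b k) + (a k - b k) / \<nu>)"
  proof (rule sum_strict_mono_ex1[OF fin])
    show "\<forall>k\<in>I. ln (1 + c k * a k) \<le> ln (1 + c k * b k) + (a k - b k) / \<nu>"
      using ln_one_plus_le_tangent(1)[OF c nonneg] slope by (meson add_left_mono order_trans)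
    show "\<exists>k\<in>I. ln (1 + c k * a k) < ln (1 + c k * b k) + (a k - b k) / \<nu>"
      using diff ln_one_plus_le_tangent(2)[OF c nonneg] slope
      by (meson add_left_mono less_le_trans)
  qed
  also have "\<dots> = (\<Sum>k\<in>I. ln (1 + c k * b k)) + (sum a I - sum b I) / \<nu>"
    by (simp add: sum.distrib sum_subtractf flip: sum_divide_distrib)
  finally show ?thesis using sums by simp
next
  case False
  \<comment> \<open>A nonpositive water level leaves every user at the lower bound, so \<open>a = b\<close>.\<close>
  have "b k = m k" if k: "k \<in> I" for k
  proof -
    have "1 / c k > 0" using c[OF k] by simp
    then show ?thesis using b[OF k] m[OF k] False by linarith
  qed
  then have "\<forall>k\<in>I. b k \<le> a k" "\<exists>k\<in>I. b k < a k"
    using a diff by force+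
  then have "sum b I < sum a I" by (rule sum_strict_mono_ex1[OF fin])
  then show ?thesis using sums by simp
qed

section \<open>A common form for both precoders\<close>

text \<open>Together with \<open>leak\<close>, the coefficient of the total communication power in
  the interference, this isolates all that distinguishes the two precoders, so that later arguments
  treat both at once.\<close>

fun array_gain :: "full_band_system \<Rightarrow> precoder \<Rightarrow> real" where
  "array_gain s MR = real (num_antennas s)"
| "array_gain s ZF = real (num_antennas s) - real (num_users s)"

fun leak :: "full_band_system \<Rightarrow> precoder \<Rightarrow> nat \<Rightarrow> real" where
  "leak s MR k = xi s k"
| "leak s ZF k = eps s k"

locale full_band =
  fixes s :: full_band_system and v :: precoder
  assumes valid: "valid_system s"
    and ZF_antennas: "v = ZF \<Longrightarrow> num_antennas s > num_users s"
begin

lemma users_nonempty: "users s \<noteq> {}"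
  using valid by (simp add: valid_system_def)

lemma sens_threshold_pos: "real (num_antennas s) * sens_gain s > 0" "masr_thr s > 0"
  using valid by (auto simp: valid_system_def)

lemma prelog_pos: "zeta_dl s * B_sys s > 0"
  using valid by (auto simp: valid_system_def)

lemma user_params:
  assumes "k \<in> users s"
  shows "array_gain s v * eta s k > 0" "leak s v k \<ge> 0" "xi s k > 0" "noise s k > 0" "R_min s k \<ge> 0"
proof -
  have p: "eta s k > 0" "eps s k \<ge> 0" "noise s k > 0" "R_min s k \<ge> 0" "num_antennas s \<ge> 1"
    using valid assms by (auto simp: valid_system_def)
  have "array_gain s v > 0"
    using p ZF_antennas by (cases v) auto
  then show "array_gain s v * eta s k > 0" using p by simp
  show "xi s k > 0" "leak s v k \<ge> 0"
    using p by (cases v; simp add: xi_def)+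
  show "noise s k > 0" "R_min s k \<ge> 0" using p by auto
qed

lemma SINR_eq:
  "SINR s v a p k = array_gain s v * eta s k * a k / (leak s v k * comm_power s a + xi s k * p + noise s k)"
  by (cases v) (simp_all add: distrib_left)

lemma star_sum: "Sc_star s + ps_star s = P_max s"
proof -
  have "real (num_antennas s) * sens_gain s + masr_thr s \<noteq> 0"
    using sens_threshold_pos by linarith
  then show ?thesis
    by (simp add: Sc_star_def ps_star_def flip: add_divide_distrib distrib_right)
qed

lemma star_ratio: "real (num_antennas s) * sens_gain s * ps_star s = masr_thr s * Sc_star s"
  by (simp add: Sc_star_def ps_star_def)

lemma star_pos: "Sc_star s > 0" "ps_star s > 0"
proof -
  have "P_max s > 0" using valid by (simp add: valid_system_def)
  then show "Sc_star s > 0" "ps_star s > 0"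
    using sens_threshold_pos by (simp_all only: Sc_star_def ps_star_def zero_less_mult_iff
        zero_less_divide_iff add_pos_pos simp_thms)
qed

text \<open>For MR, \<open>leak\<close> and \<open>xi\<close> agree and the two star powers add up
  to \<open>P_max\<close>, so the interference term splits into the form that ZF has by
  definition.\<close>

lemma chi_eq:
  "chi s v k = array_gain s v * eta s k / (leak s v k * Sc_star s + xi s k * ps_star s + noise s k)"
  by (cases v) (simp_all flip: star_sum distrib_left)

lemma interference_pos:
  assumes "k \<in> users s" "S \<ge> 0" "p \<ge> 0"
  shows "leak s v k * S + xi s k * p + noise s k > 0"
  using user_params[OF assms(1)] assms(2,3)
  by (intro add_nonneg_pos add_nonneg_nonneg mult_nonneg_nonneg) auto

lemma chi_pos: "k \<in> users s \<Longrightarrow> chi s v k > 0"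
  using interference_pos[of k "Sc_star s" "ps_star s"] user_params star_pos
  by (simp add: chi_eq)

lemma a_min_nonneg: "k \<in> users s \<Longrightarrow> a_min s v k \<ge> 0"
  using chi_pos[of k] user_params(5)[of k] prelog_pos
  by (auto simp: a_min_def gamma_min_def intro!: divide_nonneg_pos ge_one_powr_ge_zero)

text \<open>The denominator sees the communication powers only through their total. Fixing both
  totals therefore makes each SINR linear in the user's own power, which turns the problem into
  water-filling.\<close>

lemma SINR_star:
  "comm_power s a = Sc_star s \<Longrightarrow> SINR s v a (ps_star s) k = chi s v k * a k"
  by (simp add: SINR_eq chi_eq)

lemma SINR_nonneg:
  assumes "k \<in> users s" "comm_power s a \<ge> 0" "p \<ge> 0" "a k \<ge> 0"
  shows "SINR s v a p k \<ge> 0"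
  unfolding SINR_eq using user_params(1)[OF assms(1)] interference_pos[OF assms(1-3)] assms(4)
  by (intro divide_nonneg_pos mult_nonneg_nonneg[of "array_gain s v * eta s k"]) auto

lemma rate_mono:
  assumes "0 \<le> SINR s v a p k" "SINR s v a p k \<le> SINR s v a' p' k"
  shows "rate s v a p k \<le> rate s v a' p' k"
  unfolding rate_def using assms prelog_pos by (intro mult_left_mono) auto

lemma rate_strict_mono:
  assumes "0 \<le> SINR s v a p k" "SINR s v a p k < SINR s v a' p' k"
  shows "rate s v a p k < rate s v a' p' k"
  unfolding rate_def using assms prelog_pos by (intro mult_strict_left_mono) auto

lemma rate_ge_iff:
  assumes "0 \<le> SINR s v a p k"
  shows "rate s v a p k \<ge> R_min s k \<longleftrightarrow> SINR s v a p k \<ge> gamma_min s k"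
proof -
  have "rate s v a p k \<ge> R_min s k
      \<longleftrightarrow> R_min s k / (zeta_dl s * B_sys s) \<le> log 2 (1 + SINR s v a p k)"
    using prelog_pos by (simp add: rate_def pos_divide_le_eq mult.commute)
  also have "\<dots> \<longleftrightarrow> 2 powr (R_min s k / (zeta_dl s * B_sys s)) \<le> 1 + SINR s v a p k"
    using assms by (intro le_log_iff) auto
  finally show ?thesis by (auto simp: gamma_min_def)
qed

lemma comm_power_nonneg: "(\<And>k. k \<in> users s \<Longrightarrow> a k \<ge> 0) \<Longrightarrow> comm_power s a \<ge> 0"
  unfolding comm_power_def by (rule sum_nonneg)

section \<open>The problem with both totals fixed at the star values\<close>

text \<open>The sensing and budget constraints hold with equality here, so only the rate bounds
  remain; by linearity of the SINR they are lower bounds on the powers, and they imply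
  nonnegativity.\<close>

lemma feasible_at_star:
  assumes "comm_power s a = Sc_star s"
  shows "feasible_point s v a (ps_star s) \<longleftrightarrow> (\<forall>k\<in>users s. a k \<ge> a_min s v k)"
proof -
  have "R_min s k \<le> rate s v a (ps_star s) k \<longleftrightarrow> a_min s v k \<le> a k"
    if k: "k \<in> users s" and "a k \<ge> 0" for k
  proof -
    have "0 \<le> SINR s v a (ps_star s) k"
      using SINR_nonneg[OF k] assms star_pos that by simp
    from rate_ge_iff[OF this] show ?thesis
      using chi_pos[OF k] by (simp add: SINR_star[OF assms] a_min_def pos_divide_le_eq mult.commute)
  qed
  moreover have "a k \<ge> 0" if "k \<in> users s" "a k \<ge> a_min s v k" for k
    using a_min_nonneg that by force
  ultimately show ?thesis
    using star_sum star_ratio star_pos assms by (auto simp: feasible_point_def)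
qed

lemma sum_rate_star:
  assumes "comm_power s a = Sc_star s"
  shows "sum_rate s v a (ps_star s)
    = zeta_dl s * B_sys s / ln 2 * (\<Sum>k\<in>users s. ln (1 + chi s v k * a k))"
  by (simp add: sum_rate_def rate_def SINR_star[OF assms] log_def sum_distrib_left)

section \<open>Tightness of both budgets by scaling\<close>

text \<open>Adding the sensing gain times the communication power to both sides of the sensing
  constraint makes the budget applicable.\<close>

lemma comm_power_le_star:
  assumes "feasible_point s v a p"
  shows "comm_power s a \<le> Sc_star s"
proof -
  let ?g = "real (num_antennas s) * sens_gain s" and ?S = "comm_power s a"
  have f: "masr_thr s * ?S \<le> ?g * p" "?S + p \<le> P_max s"
    using assms by (auto simp: feasible_point_def)
  have "(?g + masr_thr s) * ?S \<le> ?g * (?S + p)"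
    using f by (simp add: algebra_simps)
  also have "\<dots> \<le> ?g * P_max s"
    using f sens_threshold_pos by (intro mult_left_mono) auto
  finally show ?thesis
    using sens_threshold_pos by (simp add: Sc_star_def pos_le_divide_eq mult.commute)
qed

text \<open>The difference of the two sides is a sum of a sensing term and a noise term, both
  nonnegative. If it vanishes, positive noise forces \<open>t = 1\<close> and positive
  \<open>xi\<close> then fixes \<open>p\<close>. The contrapositive of the second claim supplies
  strictness.\<close>

lemma scaled_interference_ge:
  assumes "k \<in> users s" "feasible_point s v a p" "comm_power s a > 0"
    and t_def: "t = Sc_star s / comm_power s a"
  shows "leak s v k * Sc_star s + xi s k * ps_star s + noise s k
      \<le> t * (leak s v k * comm_power s a + xi s k * p + noise s k)" (is "?L \<le> ?R")
    and "t * (leak s v k * comm_power s a + xi s k * p + noise s k)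
        \<le> leak s v k * Sc_star s + xi s k * ps_star s + noise s k
      \<Longrightarrow> comm_power s a = Sc_star s \<and> p = ps_star s"
proof -
  let ?g = "real (num_antennas s) * sens_gain s" and ?S = "comm_power s a"
  note up = user_params[OF assms(1)]
  have tS: "t * ?S = Sc_star s" using assms(3) by (simp add: t_def)
  have t: "t \<ge> 1" using comm_power_le_star[OF assms(2)] assms(3) by (simp add: t_def)
  have "?g * ps_star s = t * (masr_thr s * ?S)"
    using tS star_ratio by (simp add: mult.left_commute)
  also have "\<dots> \<le> t * (?g * p)"
    using assms(2) t by (intro mult_left_mono) (auto simp: feasible_point_def)
  finally have "?g * ps_star s \<le> ?g * (t * p)" by (simp add: mult.left_commute)
  then have tp: "ps_star s \<le> t * p"
    using sens_threshold_pos(1) by (simp only: mult_le_cancel_left_pos)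
  have R: "?R = leak s v k * Sc_star s + xi s k * (t * p) + t * noise s k"
    by (simp add: distrib_left mult.left_commute flip: tS)
  have s1: "xi s k * ps_star s \<le> xi s k * (t * p)" using up tp by simp
  have s2: "noise s k \<le> t * noise s k" using up t by simp
  show "?L \<le> ?R" unfolding R using s1 s2 by linarith
  assume "?R \<le> ?L"
  then have "xi s k * (t * p) \<le> xi s k * ps_star s" "t * noise s k \<le> noise s k"
    unfolding R using s1 s2 by linarith+
  then have "t * p \<le> ps_star s" "t \<le> 1" using up by auto
  with t tp have "t = 1" "p = ps_star s" by auto
  with tS show "?S = Sc_star s \<and> p = ps_star s" by simp
qed

text \<open>Reduces both feasibility and optimality to the star totals. The last clause is the
  equality case: an optimal point cannot be strictly improved, so it must already have these
  totals.\<close>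

lemma feasible_improve:
  assumes feas: "feasible_point s v a p"
  obtains a' where "comm_power s a' = Sc_star s" "feasible_point s v a' (ps_star s)"
    "sum_rate s v a p \<le> sum_rate s v a' (ps_star s)"
    "sum_rate s v a p = sum_rate s v a' (ps_star s) \<Longrightarrow> comm_power s a = Sc_star s \<and> p = ps_star s"
proof -
  have a0: "\<And>k. k \<in> users s \<Longrightarrow> a k \<ge> 0" and p0: "p \<ge> 0"
    using feas by (auto simp: feasible_point_def)
  have S0: "comm_power s a \<ge> 0" using comm_power_nonneg a0 by blast
  note nonneg = SINR_nonneg[OF _ S0 p0 a0]
  have "\<exists>a'. comm_power s a' = Sc_star s \<and>
      (\<forall>k\<in>users s. a' k \<ge> 0 \<and> SINR s v a p k \<le> SINR s v a' (ps_star s) k) \<and>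
      ((\<exists>k\<in>users s. SINR s v a p k < SINR s v a' (ps_star s) k) \<or>
        comm_power s a = Sc_star s \<and> p = ps_star s)"
  proof (cases "comm_power s a = 0")
    case True
    \<comment> \<open>A zero vector cannot be scaled up. All its SINRs vanish, so any strictly
      positive vector with the right total is better; the equal split is one.\<close>
    define a' where "a' k = Sc_star s / real (num_users s)" for k :: nat
    have K: "real (num_users s) > 0" using users_nonempty by simp
    have sum': "comm_power s a' = Sc_star s" using K by (simp add: comm_power_def a'_def)
    have pos': "a' k > 0" for k using K star_pos by (simp add: a'_def)
    have "a k = 0" if "k \<in> users s" for k
      using sum_nonneg_eq_0_iff[of "users s" a] True a0 that
      unfolding comm_power_def by (metis finite_atLeastAtMost)
    then have "SINR s v a p k < SINR s v a' (ps_star s) k" if "k \<in> users s" for k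
      using that chi_pos pos' by (simp add: SINR_star[OF sum']) (simp add: SINR_eq)
    then show ?thesis
      using sum' pos' users_nonempty by (intro exI[of _ a']) (auto simp: less_imp_le)
  next
    case False
    then have S: "comm_power s a > 0" using S0 by simp
    define t where "t = Sc_star s / comm_power s a"
    define a' where "a' k = t * a k" for k
    have t: "t > 0" using S star_pos by (simp add: t_def)
    have sum': "comm_power s a' = Sc_star s"
    proof -
      have "comm_power s a' = t * comm_power s a"
        by (simp add: comm_power_def a'_def sum_distrib_left)
      then show ?thesis using S by (simp add: t_def)
    qed
    let ?D = "\<lambda>k. leak s v k * comm_power s a + xi s k * p + noise s k"
    let ?D' = "\<lambda>k. leak s v k * Sc_star s + xi s k * ps_star s + noise s k"
    \<comment> \<open>Expanding the fraction by \<open>t\<close> gives both SINRs the same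
      numerator, so only the denominators need comparing.\<close>
    have S1: "SINR s v a p k = array_gain s v * eta s k * (t * a k) / (t * ?D k)" for k
      using t by (simp add: SINR_eq)
    have S2: "SINR s v a' (ps_star s) k = array_gain s v * eta s k * (t * a k) / ?D' k" for k
      by (simp add: SINR_eq sum' a'_def)
    have D: "?D k > 0" "?D' k > 0" if "k \<in> users s" for k
      using interference_pos[OF that] S p0 star_pos by auto
    note scaled = scaled_interference_ge[OF _ feas S t_def]
    have le: "SINR s v a p k \<le> SINR s v a' (ps_star s) k" if k: "k \<in> users s" for k
      unfolding S1 S2 using scaled(1)[OF k] D[OF k] t user_params(1)[OF k] a0[OF k]
      by (intro divide_left_mono mult_nonneg_nonneg[of "array_gain s v * eta s k"] mult_pos_pos) auto
    \<comment> \<open>A user without power has SINR zero before and after scaling, so strictness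
      needs a user with positive power.\<close>
    have "\<exists>k\<in>users s. a k > 0"
    proof (rule ccontr)
      assume "\<not> ?thesis"
      then have "comm_power s a \<le> 0" by (auto simp: comm_power_def not_less intro!: sum_nonpos)
      then show False using S by simp
    qed
    then obtain k where k: "k \<in> users s" "a k > 0" by blast
    have "SINR s v a p k < SINR s v a' (ps_star s) k"
      if "\<not> (comm_power s a = Sc_star s \<and> p = ps_star s)"
    proof -
      have "?D' k < t * ?D k" using scaled(2)[OF k(1)] that by fastforce
      then show ?thesis
        unfolding S1 S2 using D[OF k(1)] t user_params(1)[OF k(1)] k(2)
        by (intro divide_strict_left_mono mult_pos_pos[of t] mult_pos_pos[of "array_gain s v * eta s k"]) auto
    qed
    then show ?thesis
      using sum' le k a0 t by (intro exI[of _ a']) (auto simp: a'_def)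
  qed
  then obtain a' where a': "comm_power s a' = Sc_star s" "\<And>k. k \<in> users s \<Longrightarrow> a' k \<ge> 0"
      and le: "\<And>k. k \<in> users s \<Longrightarrow> SINR s v a p k \<le> SINR s v a' (ps_star s) k"
      and lt: "(\<exists>k\<in>users s. SINR s v a p k < SINR s v a' (ps_star s) k) \<or>
        comm_power s a = Sc_star s \<and> p = ps_star s"
    by blast
  have mono: "rate s v a p k \<le> rate s v a' (ps_star s) k" if "k \<in> users s" for k
    using rate_mono nonneg le that by blast
  show ?thesis
  proof (rule that[OF a'(1)])
    show "feasible_point s v a' (ps_star s)"
      using feas mono a' star_ratio star_sum star_pos
      by (fastforce simp: feasible_point_def intro: order_trans)
    show "sum_rate s v a p \<le> sum_rate s v a' (ps_star s)"
      unfolding sum_rate_def using mono by (intro sum_mono)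
    assume eq: "sum_rate s v a p = sum_rate s v a' (ps_star s)"
    have "\<not> (\<exists>k\<in>users s. SINR s v a p k < SINR s v a' (ps_star s) k)"
    proof
      assume "\<exists>k\<in>users s. SINR s v a p k < SINR s v a' (ps_star s) k"
      then have "\<exists>k\<in>users s. rate s v a p k < rate s v a' (ps_star s) k"
        using rate_strict_mono nonneg by blast
      then have "sum_rate s v a p < sum_rate s v a' (ps_star s)"
        unfolding sum_rate_def using mono by (intro sum_strict_mono_ex1) auto
      then show False using eq by simp
    qed
    then show "comm_power s a = Sc_star s \<and> p = ps_star s" using lt by blast
  qed
qed

section \<open>The water level, feasibility and the unique optimum\<close>

lemma water_level_exists:
  assumes "(\<Sum>k\<in>users s. a_min s v k) \<le> Sc_star s"
  shows "\<exists>\<nu>. (\<Sum>k\<in>users s. a_star s v \<nu> k) = Sc_star s"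
proof -
  obtain j where j: "j \<in> users s" using users_nonempty by blast
  \<comment> \<open>Endpoints for the intermediate value theorem: at level 0 every user sits at its
    minimum, while at level \<open>?u\<close> user \<open>j\<close> alone already takes
    \<open>Sc_star s\<close>.\<close>
  let ?F = "\<lambda>\<nu>. \<Sum>k\<in>users s. a_star s v \<nu> k" and ?u = "Sc_star s + 1 / chi s v j"
  have nonneg: "a_star s v \<nu> k \<ge> 0" if "k \<in> users s" for \<nu> k
    using a_min_nonneg[OF that] by (simp add: a_star_def)
  have "a_star s v 0 k = a_min s v k" if "k \<in> users s" for k
  proof -
    have "1 / chi s v k > 0" using chi_pos[OF that] by simp
    then show ?thesis unfolding a_star_def using a_min_nonneg[OF that] by linarith
  qed
  then have "?F 0 \<le> Sc_star s" using assms by simp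
  moreover have "Sc_star s \<le> ?F ?u"
  proof -
    have "Sc_star s \<le> a_star s v ?u j" by (simp add: a_star_def)
    also have "\<dots> \<le> ?F ?u" using j nonneg by (intro member_le_sum) auto
    finally show ?thesis .
  qed
  moreover have "0 \<le> ?u" using star_pos chi_pos[OF j] by (simp add: add_nonneg_nonneg)
  moreover have "continuous_on {0..?u} ?F"
    unfolding a_star_def by (intro continuous_intros)
  ultimately show ?thesis using IVT'[of ?F 0 "Sc_star s" ?u] by blast
qed

text \<open>Necessity moves a feasible point to the star totals and sums the lower bounds; for
  sufficiency the water-filling vector itself is a feasible point.\<close>

lemma feasible_problem_iff:
  "feasible_problem s v \<longleftrightarrow> (\<Sum>k\<in>users s. a_min s v k) \<le> Sc_star s"
proof
  assume "feasible_problem s v"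
  then obtain a p where "feasible_point s v a p" by (auto simp: feasible_problem_def)
  then obtain a' where a': "comm_power s a' = Sc_star s" "feasible_point s v a' (ps_star s)"
    by (rule feasible_improve)
  then have "\<forall>k\<in>users s. a_min s v k \<le> a' k" using feasible_at_star by blast
  then show "(\<Sum>k\<in>users s. a_min s v k) \<le> Sc_star s"
    unfolding a'(1)[symmetric] comm_power_def by (intro sum_mono) blast
next
  assume "(\<Sum>k\<in>users s. a_min s v k) \<le> Sc_star s"
  then obtain \<nu> where "comm_power s (a_star s v \<nu>) = Sc_star s"
    using water_level_exists by (auto simp: comm_power_def)
  then have "feasible_point s v (a_star s v \<nu>) (ps_star s)"
    by (simp add: feasible_at_star) (simp add: a_star_def)
  then show "feasible_problem s v" by (auto simp: feasible_problem_def)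
qed

lemma sum_rate_less_a_star:
  assumes \<nu>: "(\<Sum>k\<in>users s. a_star s v \<nu> k) = Sc_star s"
    and a: "comm_power s a = Sc_star s" "feasible_point s v a (ps_star s)"
    and diff: "\<exists>k\<in>users s. a k \<noteq> a_star s v \<nu> k"
  shows "sum_rate s v a (ps_star s) < sum_rate s v (a_star s v \<nu>) (ps_star s)"
proof -
  have b: "comm_power s (a_star s v \<nu>) = Sc_star s" using \<nu> by (simp add: comm_power_def)
  have "(\<Sum>k\<in>users s. ln (1 + chi s v k * a k))
      < (\<Sum>k\<in>users s. ln (1 + chi s v k * a_star s v \<nu> k))"
  proof (rule water_filling_strict[where m = "a_min s v" and \<nu> = \<nu>])
    show "sum a (users s) = sum (a_star s v \<nu>) (users s)"
      using a \<nu> by (simp add: comm_power_def)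
    show "a_min s v k \<le> a k" if "k \<in> users s" for k
      using a feasible_at_star that by blast
  qed (use chi_pos a_min_nonneg diff in \<open>auto simp: a_star_def\<close>)
  then show ?thesis
    unfolding sum_rate_star[OF a(1)] sum_rate_star[OF b]
    using prelog_pos by (intro mult_strict_left_mono) (auto intro!: divide_pos_pos)
qed

text \<open>Stated for every admissible \<nu>, since the level is not unique when the minimum powers
  already exhaust \<open>Sc_star s\<close>: all sufficiently low levels then give the same
  powers.\<close>

lemma optimal_point_iff:
  assumes \<nu>: "(\<Sum>k\<in>users s. a_star s v \<nu> k) = Sc_star s"
  shows "optimal_point s v a p \<longleftrightarrow> p = ps_star s \<and> (\<forall>k\<in>users s. a k = a_star s v \<nu> k)"
proof
  have b: "comm_power s (a_star s v \<nu>) = Sc_star s" using \<nu> by (simp add: comm_power_def)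
  then have feas_b: "feasible_point s v (a_star s v \<nu>) (ps_star s)"
    by (simp add: feasible_at_star) (simp add: a_star_def)
  assume opt: "optimal_point s v a p"
  then have feas: "feasible_point s v a p" by (simp add: optimal_point_def)
  then obtain a' where "comm_power s a' = Sc_star s" "feasible_point s v a' (ps_star s)"
    "sum_rate s v a p \<le> sum_rate s v a' (ps_star s)"
    "sum_rate s v a p = sum_rate s v a' (ps_star s) \<Longrightarrow> comm_power s a = Sc_star s \<and> p = ps_star s"
    using feasible_improve by blast
  \<comment> \<open>Optimality bounds the rate of the improved point from above, so the two sum
    rates coincide and the equality case applies.\<close>
  with opt have tight: "comm_power s a = Sc_star s" "p = ps_star s"
    by (meson optimal_point_def order_antisym)+
  have "\<not> sum_rate s v a (ps_star s) < sum_rate s v (a_star s v \<nu>) (ps_star s)"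
    using opt feas_b tight by (simp add: optimal_point_def not_less)
  then show "p = ps_star s \<and> (\<forall>k\<in>users s. a k = a_star s v \<nu> k)"
    using sum_rate_less_a_star[OF \<nu>] tight feas by blast
next
  assume a: "p = ps_star s \<and> (\<forall>k\<in>users s. a k = a_star s v \<nu> k)"
  then have sum_a: "comm_power s a = Sc_star s" using \<nu> by (simp add: comm_power_def)
  have "\<forall>k\<in>users s. a k \<ge> a_min s v k" using a by (simp add: a_star_def)
  then have feas: "feasible_point s v a p" using feasible_at_star[OF sum_a] a by simp
  have b: "comm_power s (a_star s v \<nu>) = Sc_star s" using \<nu> by (simp add: comm_power_def)
  \<comment> \<open>Power vectors are functions on all naturals and may differ outside
    \<open>users s\<close>, so agreement on the users has to be transferred to the sum rate.\<close>
  have eq: "sum_rate s v c (ps_star s) = sum_rate s v (a_star s v \<nu>) (ps_star s)"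
    if "comm_power s c = Sc_star s" "\<forall>k\<in>users s. c k = a_star s v \<nu> k" for c
    using that by (simp add: sum_rate_star b)
  have "sum_rate s v a' p' \<le> sum_rate s v a p" if "feasible_point s v a' p'" for a' p'
  proof -
    from that obtain c where c: "comm_power s c = Sc_star s" "feasible_point s v c (ps_star s)"
      "sum_rate s v a' p' \<le> sum_rate s v c (ps_star s)"
      by (rule feasible_improve)
    note c(3)
    also have "sum_rate s v c (ps_star s) \<le> sum_rate s v (a_star s v \<nu>) (ps_star s)"
      using sum_rate_less_a_star[OF \<nu> c(1,2)] eq[OF c(1)]
      by (cases "\<forall>k\<in>users s. c k = a_star s v \<nu> k") (auto simp: less_imp_le)
    also have "\<dots> = sum_rate s v a p" using eq[OF sum_a] a by simp
    finally show ?thesis .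
  qed
  with feas show "optimal_point s v a p" by (simp add: optimal_point_def)
qed

end

theorem proposition3:
  fixes s :: full_band_system and v :: precoder
  assumes valid: "valid_system s"
    and ZF_antennas: "v = ZF \<Longrightarrow> num_antennas s > num_users s"
  shows "(feasible_problem s v \<longleftrightarrow> (\<Sum>k\<in>users s. a_min s v k) \<le> Sc_star s) \<and>
    ((\<Sum>k\<in>users s. a_min s v k) \<le> Sc_star s \<longrightarrow>
       (\<exists>a p. optimal_point s v a p) \<and>
       (\<forall>a p. optimal_point s v a p \<longrightarrow> p = ps_star s \<and> comm_power s a = Sc_star s) \<and>
       (\<exists>\<nu>. (\<Sum>k\<in>users s. a_star s v \<nu> k) = Sc_star s) \<and>
       (\<forall>\<nu>. (\<Sum>k\<in>users s. a_star s v \<nu> k) = Sc_star s \<longrightarrow>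
          (\<forall>a p. optimal_point s v a p \<longleftrightarrow>
                   p = ps_star s \<and> (\<forall>k\<in>users s. a k = a_star s v \<nu> k)) \<and>
          (\<forall>a p A q. optimal_point s v a p \<and> uniform_loading s a p A q \<longrightarrow>
             (\<forall>n\<in>subcarriers s.
                (\<forall>k\<in>users s. A k n = a_star s v \<nu> k / real (num_subcarriers s)) \<and>
                q n = ps_star s / real (num_subcarriers s)))))"
proof -
  interpret full_band s v using assms by unfold_locales auto
  show ?thesis
  proof (intro conjI impI)
    show "feasible_problem s v \<longleftrightarrow> (\<Sum>k\<in>users s. a_min s v k) \<le> Sc_star s"
      by (rule feasible_problem_iff)
  next
    assume "(\<Sum>k\<in>users s. a_min s v k) \<le> Sc_star s"
    then show ex: "\<exists>\<nu>. (\<Sum>k\<in>users s. a_star s v \<nu> k) = Sc_star s"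
      by (rule water_level_exists)
    then obtain \<nu> where \<nu>: "(\<Sum>k\<in>users s. a_star s v \<nu> k) = Sc_star s" ..
    show "\<exists>a p. optimal_point s v a p" using optimal_point_iff[OF \<nu>] by blast
    show "\<forall>a p. optimal_point s v a p \<longrightarrow> p = ps_star s \<and> comm_power s a = Sc_star s"
      using optimal_point_iff[OF \<nu>] \<nu> by (simp add: comm_power_def)
  qed (simp add: optimal_point_iff uniform_loading_def)
qed

end
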